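(* Let $k\ge1$ and $m\ge1$ be integers. Then there exists an integer $b$ such that $\varphi(b,m,k)=\varphi_{min}(m,k)$ and such that for every odd prime $p$ dividing $m-1$, $$F_{b,m}(p)=\left\lceil\frac{m}{p}\right\rceil\ \Longrightarrow\ F_{b,m}(2p)=\left\lceil\frac{m}{2p}\right\rceil.$$
   Context: $p_i$ denotes the $i$-th prime ($p_1=2$) and $P_k=p_1\cdots p_k$. For integers $b$, $m\ge0$, $d\ge1$, $F_{b,m}(d)$ is the number of integers $a$ with $b<a\le b+m$ and $d\mid a$. $\varphi(b,m,k)$ is the number of integers $a$ with $b<a\le b+m$ and $\gcd(a,P_k)=1$, and $\varphi_{min}(m,k)=\min_{b\in\mathbb{Z}}\varphi(b,m,k)$. *)

theory Defs
  imports Complex_Main "HOL-Computational_Algebra.Primes" "HOL-Library.Infinite_Set"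
begin

text \<open>One-based indexing: \<open>nth_prime 1 = 2\<close>. The index \<open>0\<close> carries no meaning and is not used.\<close>

definition nth_prime :: "nat \<Rightarrow> nat" where
  "nth_prime i = enumerate {p. prime p} (i - 1)"

definition primorial :: "nat \<Rightarrow> nat" where
  "primorial k = (\<Prod>i=1..k. nth_prime i)"

definition mult_count :: "int \<Rightarrow> nat \<Rightarrow> nat \<Rightarrow> nat" where
  "mult_count b m d = card {a. b < a \<and> a \<le> b + int m \<and> int d dvd a}"

definition coprime_count :: "int \<Rightarrow> nat \<Rightarrow> nat \<Rightarrow> nat" where
  "coprime_count b m k = card {a. b < a \<and> a \<le> b + int m \<and> gcd a (int (primorial k)) = 1}"

definition coprime_count_min :: "nat \<Rightarrow> nat \<Rightarrow> nat" where
  "coprime_count_min m k = Min (range (\<lambda>b. coprime_count b m k))"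

text \<open>The minimum is over a finite set of values, so \<^const>\<open>Min\<close> is meaningful.\<close>

lemma finite_range_coprime_count: "finite (range (\<lambda>b. coprime_count b m k))"
proof (rule finite_subset)
  show "range (\<lambda>b. coprime_count b m k) \<subseteq> {..m}"
  proof clarsimp
    fix b
    have "coprime_count b m k \<le> card {b<..b + int m}"
      unfolding coprime_count_def by (rule card_mono) auto
    then show "coprime_count b m k \<le> m" by simp
  qed
qed simp

lemma nth_prime_1: "nth_prime 1 = 2"
  unfolding nth_prime_def
  by (auto simp: enumerate_0 intro!: Least_equality prime_ge_2_nat)

end

theory Submission imports Defs begin

text \<open>
  Write \<open>m - 1 = q p\<close>. The interval \<open>(b, b + m]\<close> attains \<open>\<lceil>m/p\<rceil>\<close> multiples of \<open>p\<close> exactly when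
  \<open>p\<close> divides \<open>b + 1\<close>. If \<open>q\<close> is odd, the \<open>q + 1\<close> multiples of \<open>p\<close> alternate in parity and half
  of them are multiples of \<open>2p\<close>, for every \<open>b\<close>. If \<open>q\<close> is even, it suffices that \<open>b\<close> is odd. A
  minimiser \<open>b\<close> can always be taken odd: if \<open>b\<close> is even, moving the interval one step to the left
  brings in only the even number \<open>b\<close>, so the count of integers coprime to \<open>P\<^sub>k\<close> does not increase.
\<close>

lemma int_le_div_iff_mult_le:
  fixes a c d :: int
  assumes "d > 0"
  shows "c \<le> a div d \<longleftrightarrow> d * c \<le> a"
  using assms
  by (smt (verit, ccfv_SIG) mod_mult_div_eq nonzero_mult_div_cancel_left pos_mod_sign zdiv_mono1)

text \<open>The multiples of \<open>d\<close> in the window are the \<open>d * c\<close> with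
  \<open>c\<close> in \<open>(b div d, (b + m) div d]\<close>, so counting them reduces to the
  length of an interval of quotients.\<close>

lemma mult_count_eq_div:
  assumes "d > 0"
  shows "int (mult_count b m d) = (b + int m) div int d - b div int d"
proof -
  have range_iff: "c \<in> {b div int d <.. (b + int m) div int d}
      \<longleftrightarrow> b < int d * c \<and> int d * c \<le> b + int m" for c
    using assms int_le_div_iff_mult_le[of "int d" c b] int_le_div_iff_mult_le[of "int d" c "b + int m"]
    by (simp only: greaterThanAtMost_iff of_nat_0_less_iff flip: not_le)
  have "{a. b < a \<and> a \<le> b + int m \<and> int d dvd a}
      = (\<lambda>c. int d * c) ` {b div int d <.. (b + int m) div int d}"
    unfolding image_def Bex_def range_iff dvd_def by blast
  moreover have "inj_on (\<lambda>c. int d * c) {b div int d <.. (b + int m) div int d}"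
    using assms by (simp add: inj_on_def)
  ultimately have "mult_count b m d = card {b div int d <.. (b + int m) div int d}"
    unfolding mult_count_def by (simp only: card_image)
  moreover have "b div int d \<le> (b + int m) div int d"
    using assms by (intro zdiv_mono1) auto
  ultimately show ?thesis by simp
qed

lemma ceiling_divide_nat_eq_div:
  "\<lceil>real m / real d\<rceil> = - ((- int m) div int d)"
  using ceiling_divide_eq_div[where 'a=real, of "int m" "int d"] by simp

lemma ceiling_divide_mult_add:
  assumes "0 < r" and "r \<le> d"
  shows "\<lceil>real (q * d + r) / real d\<rceil> = int q + 1"
proof -
  \<comment> \<open>The remainder is \<open>d - r\<close>, which lies in \<open>[0, d)\<close>
    because \<open>0 < r\<close> and \<open>r \<le> d\<close>.\<close>
  have "(- int (q * d + r)) div int d = - int q - 1"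
    by (rule int_div_pos_eq[where r = "int d - int r"])
       (use assms in \<open>auto simp: algebra_simps\<close>)
  then show ?thesis by (simp only: ceiling_divide_nat_eq_div)
qed

text \<open>A window of \<open>q * d + 1\<close> consecutive integers holds at least
  \<open>q\<close> multiples of \<open>d\<close>; it holds one more only when its first and last
  elements are both multiples. The ceiling is this larger count \<open>q + 1\<close>.\<close>

lemma mult_count_eq_ceiling_iff:
  assumes "d \<ge> 2"
  shows "int (mult_count b (q * d + 1) d) = \<lceil>real (q * d + 1) / real d\<rceil> \<longleftrightarrow> int d dvd b + 1"
proof -
  have "(b + int (q * d + 1)) div int d = int q + (b + 1) div int d"
    using assms div_mult_self1[of "int d" "b + 1" "int q"] by (simp add: algebra_simps)
  \<comment> \<open>Going from \<open>b\<close> to \<open>b + 1\<close> raises the quotient only on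
    reaching a multiple of \<open>d\<close>.\<close>
  moreover have "b div int d = (b + 1) div int d - (if int d dvd b + 1 then 1 else 0)"
  proof (cases "int d dvd b + 1")
    case True
    have "b div int d = (b + 1) div int d - 1"
      by (rule int_div_pos_eq[where r = "int d - 1"])
         (use assms dvd_mult_div_cancel[OF True] in \<open>auto simp: right_diff_distrib\<close>)
    with True show ?thesis by simp
  next
    case False
    then have "(b + 1) mod int d > 0"
      using assms by (simp add: dvd_eq_mod_eq_0 order_less_le)
    moreover have "(b + 1) mod int d < int d"
      using assms by simp
    ultimately have "b div int d = (b + 1) div int d"
      using mult_div_mod_eq[of "int d" "b + 1"]
      by (intro int_div_pos_eq[where r = "(b + 1) mod int d - 1"]) linarith+
    with False show ?thesis by simp
  qed
  ultimately show ?thesis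
    using assms by (simp only: mult_count_eq_div ceiling_divide_mult_add) simp
qed

text \<open>The window runs from \<open>p * c\<close> to \<open>p * (c + 2 * r + 1)\<close>. Among
  the \<open>2 * r + 2\<close> consecutive cofactors exactly \<open>r + 1\<close> are even, whatever
  the parity of \<open>c\<close>.\<close>

lemma mult_count_double_eq_ceiling:
  assumes "p > 0" and "int p dvd b + 1"
  shows "int (mult_count b ((2 * r + 1) * p + 1) (2 * p))
    = \<lceil>real ((2 * r + 1) * p + 1) / real (2 * p)\<rceil>"
proof -
  obtain c where c: "b = int p * c - 1"
    using assms(2) by (metis add_diff_cancel_right' dvd_def)
  \<comment> \<open>Relative to the divisor \<open>2 * p\<close> the remainder is
    \<open>p + 1\<close>, at most \<open>2 * p\<close> since \<open>p > 0\<close>; hence the ceiling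
    is \<open>r + 1\<close>.\<close>
  have m: "(2 * r + 1) * p + 1 = r * (2 * p) + (p + 1)" by (simp add: algebra_simps)
  have p: "int (2 * p) = int p * 2" by simp
  have "(b + int ((2 * r + 1) * p + 1)) div int (2 * p) = (int p * (c + 1 + 2 * int r)) div (int p * 2)"
    by (simp add: c algebra_simps)
  also have "\<dots> = int r + (c + 1) div 2"
    using assms(1) by simp
  finally have "(b + int ((2 * r + 1) * p + 1)) div int (2 * p) = int r + (c + 1) div 2" .
  moreover have "b div int p = c - 1"
    by (rule int_div_pos_eq[where r = "int p - 1"]) (use assms(1) c in \<open>auto simp: algebra_simps\<close>)
  then have "b div int (2 * p) = (c - 1) div 2"
    by (simp only: p) (simp add: zdiv_zmult2_eq)
  moreover have "(c + 1) div 2 = (c - 1) div 2 + 1" by presburger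
  moreover have "\<lceil>real (r * (2 * p) + (p + 1)) / real (2 * p)\<rceil> = int r + 1"
    by (rule ceiling_divide_mult_add) (use assms(1) in auto)
  ultimately show ?thesis
    using assms(1) by (simp only: mult_count_eq_div flip: m)
qed

lemma even_primorial:
  assumes "k \<ge> 1"
  shows "even (primorial k)"
proof -
  have "nth_prime 1 dvd primorial k"
    unfolding primorial_def by (rule dvd_prodI) (use assms in auto)
  then show ?thesis by (simp only: nth_prime_1)
qed

lemma coprime_count_shift_left_le:
  assumes "k \<ge> 1" and "even b"
  shows "coprime_count (b - 1) m k \<le> coprime_count b m k"
  unfolding coprime_count_def
proof (rule card_mono)
  show "finite {a. b < a \<and> a \<le> b + int m \<and> gcd a (int (primorial k)) = 1}"
    by (rule finite_subset[of _ "{b<..b + int m}"]) auto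
  have "2 dvd gcd b (int (primorial k))"
    using assms even_primorial by simp
  then have not_coprime: "gcd b (int (primorial k)) \<noteq> 1" by auto
  show "{a. b - 1 < a \<and> a \<le> b - 1 + int m \<and> gcd a (int (primorial k)) = 1}
    \<subseteq> {a. b < a \<and> a \<le> b + int m \<and> gcd a (int (primorial k)) = 1}"
  proof (intro subsetI CollectI)
    fix a assume "a \<in> {a. b - 1 < a \<and> a \<le> b - 1 + int m \<and> gcd a (int (primorial k)) = 1}"
    then have "b - 1 < a" "a \<le> b - 1 + int m" and gcd: "gcd a (int (primorial k)) = 1" by blast+
    moreover have "a \<noteq> b" using gcd not_coprime by blast
    ultimately show "b < a \<and> a \<le> b + int m \<and> gcd a (int (primorial k)) = 1" by linarith
  qed
qed

lemma coprime_count_min_le: "coprime_count_min m k \<le> coprime_count b m k"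
  unfolding coprime_count_min_def by (rule Min_le[OF finite_range_coprime_count]) simp

text \<open>Oddness of \<open>b\<close> makes the first element \<open>b + 1\<close> of the window
  even, which supplies the factor 2 when \<open>2 * p\<close> must divide
  \<open>b + 1\<close>.\<close>

lemma coprime_count_min_attained_odd:
  assumes "k \<ge> 1"
  obtains b where "odd b" and "coprime_count b m k = coprime_count_min m k"
proof -
  have "coprime_count_min m k \<in> range (\<lambda>b. coprime_count b m k)"
    unfolding coprime_count_min_def by (rule Min_in[OF finite_range_coprime_count]) simp
  then obtain b where b: "coprime_count b m k = coprime_count_min m k" by auto
  show thesis
  proof (cases "even b")
    case True
    then have "coprime_count (b - 1) m k = coprime_count_min m k"
      using coprime_count_shift_left_le[OF assms True, of m] coprime_count_min_le[of m k "b - 1"] b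
      by simp
    with True show thesis by (intro that[of "b - 1"]) auto
  next
    case False
    with b show thesis by (intro that)
  qed
qed

theorem theorem4p3:
  fixes k m :: nat
  assumes "k \<ge> 1" and "m \<ge> 1"
  shows "\<exists>b::int. coprime_count b m k = coprime_count_min m k \<and>
    (\<forall>p::nat. prime p \<and> odd p \<and> p dvd m - 1 \<longrightarrow>
      int (mult_count b m p) = \<lceil>real m / real p\<rceil> \<longrightarrow>
      int (mult_count b m (2 * p)) = \<lceil>real m / real (2 * p)\<rceil>)"
proof -
  obtain b where b: "odd b" "coprime_count b m k = coprime_count_min m k"
    using coprime_count_min_attained_odd[OF assms(1)] .
  have "int (mult_count b m (2 * p)) = \<lceil>real m / real (2 * p)\<rceil>"
    if p: "prime p" "odd p" "p dvd m - 1" and F: "int (mult_count b m p) = \<lceil>real m / real p\<rceil>" for p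
  proof -
    have p2: "p \<ge> 2" using p(1) by (rule prime_ge_2_nat)
    obtain q where "m - 1 = q * p" using p(3) by (metis dvd_def mult.commute)
    then have m: "m = q * p + 1" using assms(2) by simp
    have dvd: "int p dvd b + 1"
      using F mult_count_eq_ceiling_iff[OF p2] unfolding m by blast
    show ?thesis
    proof (cases "even q")
      case True
      then obtain r where "q = 2 * r" by auto
      then have m': "m = r * (2 * p) + 1" using m by simp
      have "coprime 2 (int p)" using p(2) by simp
      then have "int (2 * p) dvd b + 1"
        using divides_mult[of 2 "b + 1" "int p"] dvd b(1) by simp
      \<comment> \<open>The same criterion is now read from right to left, with divisor
        \<open>2 * p\<close> and quotient \<open>r\<close>.\<close>
      then show ?thesis
        using mult_count_eq_ceiling_iff[of "2 * p" b r] p2 unfolding m' by simp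
    next
      case False
      then obtain r where "q = 2 * r + 1" by (auto elim: oddE)
      then show ?thesis
        using mult_count_double_eq_ceiling[OF _ dvd] p2 m by simp
    qed
  qed
  with b(2) show ?thesis by blast
qed

end
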